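(* Let $q=4k+1$ be a prime power with $k$ odd, let $\alpha$ be a primitive element of the finite field $\mathbb{F}_q$, and let $D^4_i=\{\alpha^{i+4j}:0\le j\le k-1\}$ for $0\le i\le 3$. Let $\mathcal{S}=\{S_1,S_2,S_3\}$ be the family of disjoint subsets of $\mathbb{Z}_2\times\mathbb{F}_q$ given by $$S_1=\{(0,0),(1,0)\},\quad S_2=(\{0\}\times D^4_0)\cup(\{1\}\times D^4_2),\quad S_3=(\{0\}\times D^4_1)\cup(\{0\}\times D^4_3).$$ Then $\mathcal{S}$ is an optimal $(n=2q,\ m=3,\ (2,2k,2k),\ a=4k+2,\ \lambda=2k+1)$-BSWEDF.
   Context: The group is the additive group $\mathbb{Z}_2\times\mathbb{F}_q$. For multi-sets $B_1,B_2$ of elements of an Abelian group $G$ of order $n$, $D(B_1,B_2)$ is the multi-set $\{x-y : x\in B_1,\ y\in B_2\}$; $k\boxtimes B$ is the multi-set in which each element of $B$ is repeated $k$ times; unions are multi-set unions. Let $\mathcal{B}=\{B_i : 1\le i\le m\}$ be a family of pairwise disjoint nonempty subsets of $G$, $k_i=|B_i|$, $K=(k_1,\dots,k_m)$, $a=\sum_i k_i$, $\widetilde{k}=\mathrm{lcm}(k_1,\dots,k_m)$, $\widetilde{B}_i=\frac{\widetilde{k}}{k_i}\boxtimes B_i$. Then $\mathcal{B}$ is an $(n,m,K,a,\lambda)$-BSWEDF (bounded standard weighted external difference family) if $\lambda$ is the smallest positive integer such that $\bigcup_{1\le i\ne j\le m}D(B_i,\widetilde{B}_j)\subseteq\lambda\boxtimes(G\setminus\{0\})$.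 It is optimal if $\lambda$ takes the smallest possible value among all BSWEDFs (over Abelian groups of order $n$) with the given $n,m,K$. *)

theory Defs
  imports
    "HOL-Library.Multiset"
    "HOL-Number_Theory.Prime_Powers"
    "HOL-Algebra.Multiplicative_Group"
    "HOL-Algebra.Elementary_Groups"
begin

text \<open>
  Abelian groups are \<^locale>\<open>comm_group\<close>s, hence written multiplicatively: the difference
  $x - y$ is \<open>x \<otimes> inv y\<close> and the neutral element $0$ is \<open>\<one>\<close>.
\<close>

definition diff_mset :: "('a, 'x) monoid_scheme \<Rightarrow> 'a multiset \<Rightarrow> 'a multiset \<Rightarrow> 'a multiset" where
  "diff_mset G B C = (\<Sum>x\<in>#B. {# x \<otimes>\<^bsub>G\<^esub> inv\<^bsub>G\<^esub> y. y \<in># C #})"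

text \<open>
  An indexed family $B_1, \dots, B_m$ is a list of sets; indices start at 0.
\<close>

definition weighted_set :: "'a set list \<Rightarrow> nat \<Rightarrow> 'a multiset" where
  "weighted_set Bs j =
     repeat_mset (Lcm (set (map card Bs)) div card (Bs ! j)) (mset_set (Bs ! j))"

definition external_diffs :: "('a, 'x) monoid_scheme \<Rightarrow> 'a set list \<Rightarrow> 'a multiset" where
  "external_diffs G Bs =
     (\<Sum>(i, j) \<in> {(i, j). i < length Bs \<and> j < length Bs \<and> i \<noteq> j}.
        diff_mset G (mset_set (Bs ! i)) (weighted_set Bs j))"

definition diffs_bounded_by :: "('a, 'x) monoid_scheme \<Rightarrow> 'a set list \<Rightarrow> nat \<Rightarrow> bool" where
  "diffs_bounded_by G Bs l \<longleftrightarrow>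
     external_diffs G Bs \<subseteq># repeat_mset l (mset_set (carrier G - {\<one>\<^bsub>G\<^esub>}))"

definition BSWEDF ::
  "('a, 'x) monoid_scheme \<Rightarrow> nat \<Rightarrow> nat \<Rightarrow> nat list \<Rightarrow> nat \<Rightarrow> nat \<Rightarrow> 'a set list \<Rightarrow> bool" where
  "BSWEDF G n m K a l Bs \<longleftrightarrow>
     comm_group G \<and> finite (carrier G) \<and> order G = n \<and>
     length Bs = m \<and>
     (\<forall>B \<in> set Bs. B \<noteq> {} \<and> B \<subseteq> carrier G) \<and>
     (\<forall>i < m. \<forall>j < m. i \<noteq> j \<longrightarrow> Bs ! i \<inter> Bs ! j = {}) \<and>
     map card Bs = K \<and> sum_list K = a \<and>
     0 < l \<and> diffs_bounded_by G Bs l \<and>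
     (\<forall>l'. 0 < l' \<and> diffs_bounded_by G Bs l' \<longrightarrow> l \<le> l')"

text \<open>
  Optimality compares with families over all Abelian groups of order \<open>n\<close>. A definition cannot
  quantify over types, so the competing groups have carriers in \<^typ>\<open>nat\<close>; every finite group is
  isomorphic to such a group, and \<open>optimal_BSWEDF_le\<close> below shows that the comparison
  extends to groups over any type.
\<close>

definition optimal_BSWEDF ::
  "('a, 'x) monoid_scheme \<Rightarrow> nat \<Rightarrow> nat \<Rightarrow> nat list \<Rightarrow> nat \<Rightarrow> nat \<Rightarrow> 'a set list \<Rightarrow> bool" where
  "optimal_BSWEDF G n m K a l Bs \<longleftrightarrow>
     BSWEDF G n m K a l Bs \<and>
     (\<forall>(H :: nat monoid) a' l' Cs. BSWEDF H n m K a' l' Cs \<longrightarrow> l \<le> l')"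

definition primitive_element :: "('a, 'x) ring_scheme \<Rightarrow> 'a \<Rightarrow> bool" where
  "primitive_element R \<alpha> \<longleftrightarrow>
     \<alpha> \<in> carrier (mult_of R) \<and> generate (mult_of R) {\<alpha>} = carrier (mult_of R)"

text \<open>
  With $q = 4k + 1$ this is the cyclotomic class $D^4_i$ of \<open>R\<close>.
\<close>

definition quartic_class :: "('a, 'x) ring_scheme \<Rightarrow> 'a \<Rightarrow> nat \<Rightarrow> nat \<Rightarrow> 'a set" where
  "quartic_class R \<alpha> k i = {\<alpha> [^]\<^bsub>R\<^esub> (i + 4 * j) | j. j < k}"


lemma image_mset_repeat_mset: "image_mset f (repeat_mset n A) = repeat_mset n (image_mset f A)"
  by (induction n) auto

lemma in_repeat_msetD: "x \<in># repeat_mset n A \<Longrightarrow> x \<in># A"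
  by (induction n) auto

lemma image_mset_sum: "image_mset f (sum g A) = (\<Sum>x\<in>A. image_mset f (g x))"
  by (induction A rule: infinite_finite_induct) auto

lemma diff_mset_iso:
  assumes "group G" "group H" "h \<in> iso G H"
    and "set_mset B \<subseteq> carrier G" "set_mset C \<subseteq> carrier G"
  shows "diff_mset H (image_mset h B) (image_mset h C) = image_mset h (diff_mset G B C)"
proof -
  interpret group_hom G H h
    using assms by (simp add: group_hom_def group_hom_axioms_def iso_def)
  have "image_mset (\<lambda>y. h x \<otimes>\<^bsub>H\<^esub> inv\<^bsub>H\<^esub> y) (image_mset h C) =
      image_mset h (image_mset (\<lambda>y. x \<otimes>\<^bsub>G\<^esub> inv\<^bsub>G\<^esub> y) C)" if "x \<in> carrier G" for x
    using assms(5) that by (auto simp: multiset.map_comp subset_iff intro!: image_mset_cong)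
  with assms(4) show ?thesis
    unfolding diff_mset_def by (induction B) auto
qed

lemma diffs_bounded_by_iso:
  assumes G: "group G" and H: "group H" and h: "h \<in> iso G H"
    and Bs: "\<And>B. B \<in> set Bs \<Longrightarrow> B \<subseteq> carrier G"
    and bd: "diffs_bounded_by G Bs l"
  shows "diffs_bounded_by H (map ((`) h) Bs) l"
proof -
  have inj: "inj_on h (carrier G)" and im: "h ` carrier G = carrier H"
    using h by (auto simp: iso_def bij_betw_def)
  have one: "h \<one>\<^bsub>G\<^esub> = \<one>\<^bsub>H\<^esub>"
    using hom_one[OF _ G H] h by (auto simp: iso_def)
  have sub: "Bs ! i \<subseteq> carrier G" if "i < length Bs" for i
    using Bs that by simp
  have card_eq: "map card (map ((`) h) Bs) = map card Bs"
    using Bs inj by (auto intro!: card_image intro: inj_on_subset)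
  have img: "mset_set (h ` (Bs ! i)) = image_mset h (mset_set (Bs ! i))" if "i < length Bs" for i
    using image_mset_mset_set[OF inj_on_subset[OF inj sub[OF that]]] by simp
  have in_carrier: "set_mset (mset_set (Bs ! i)) \<subseteq> carrier G" if "i < length Bs" for i
    using sub[OF that] by (cases "finite (Bs ! i)") auto
  have wt: "weighted_set (map ((`) h) Bs) j = image_mset h (weighted_set Bs j)"
    if j: "j < length Bs" for j
  proof -
    have "card (map ((`) h) Bs ! j) = card (Bs ! j)"
      using arg_cong[OF card_eq, of "\<lambda>xs. xs ! j"] j by simp
    then show ?thesis
      unfolding weighted_set_def card_eq using img[OF j] j
      by (simp add: image_mset_repeat_mset)
  qed
  have wt_carrier: "set_mset (weighted_set Bs j) \<subseteq> carrier G" if "j < length Bs" for j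
    using in_carrier[OF that] by (auto simp: weighted_set_def dest: in_repeat_msetD)
  have "external_diffs H (map ((`) h) Bs) = image_mset h (external_diffs G Bs)"
    unfolding external_diffs_def image_mset_sum
    by (auto simp: image_mset_sum wt img
        intro!: sum.cong diff_mset_iso[OF G H h in_carrier wt_carrier])
  also have "\<dots> \<subseteq># image_mset h (repeat_mset l (mset_set (carrier G - {\<one>\<^bsub>G\<^esub>})))"
    using bd unfolding diffs_bounded_by_def by (rule image_mset_subseteq_mono)
  also have "\<dots> = repeat_mset l (mset_set (h ` (carrier G - {\<one>\<^bsub>G\<^esub>})))"
    using image_mset_mset_set[OF inj_on_subset[OF inj, of "carrier G - {\<one>\<^bsub>G\<^esub>}"]]
    by (simp add: image_mset_repeat_mset)
  also have "h ` (carrier G - {\<one>\<^bsub>G\<^esub>}) = carrier H - {\<one>\<^bsub>H\<^esub>}"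
    using inj_on_image_set_diff[OF inj, of "carrier G" "{\<one>\<^bsub>G\<^esub>}"] im one
      monoid.one_closed[OF group.is_monoid[OF G]] by auto
  finally show ?thesis
    by (simp add: diffs_bounded_by_def)
qed

lemma BSWEDF_iso:
  assumes H: "comm_group H" and h: "h \<in> iso G H" and B: "BSWEDF G n m K a l Bs"
  shows "BSWEDF H n m K a l (map ((`) h) Bs)"
proof -
  have G: "group G" and H': "group H" and Bs: "\<And>B. B \<in> set Bs \<Longrightarrow> B \<subseteq> carrier G"
    using B H by (auto simp: BSWEDF_def comm_group_def)
  have inj: "inj_on h (carrier G)" and im: "h ` carrier G = carrier H"
    using h by (auto simp: iso_def bij_betw_def)
  let ?g = "inv_into (carrier G) h"
  have g: "?g \<in> iso H G"
    using group.iso_set_sym[OF G h] .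
  have "?g ` h ` B = B" if "B \<in> set Bs" for B
    using inj Bs[OF that] by (simp add: inv_into_image_cancel)
  then have undo: "map ((`) ?g) (map ((`) h) Bs) = Bs"
    by (simp add: map_idI)
  have hBs: "B \<subseteq> carrier H" if "B \<in> set (map ((`) h) Bs)" for B
    using that Bs im by auto
  have bound_iff: "diffs_bounded_by H (map ((`) h) Bs) l' \<longleftrightarrow> diffs_bounded_by G Bs l'" for l'
    using diffs_bounded_by_iso[OF G H' h Bs] diffs_bounded_by_iso[OF H' G g hBs] undo by metis
  have card_eq: "map card (map ((`) h) Bs) = map card Bs"
    using Bs inj by (auto intro!: card_image intro: inj_on_subset)
  have disj: "h ` (Bs ! i) \<inter> h ` (Bs ! j) = {}"
    if "i < length Bs" "j < length Bs" "Bs ! i \<inter> Bs ! j = {}" for i j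
    using inj_on_image_Int[OF inj, of "Bs ! i" "Bs ! j"] Bs that by simp
  have "finite (carrier H)" "order H = order G"
    using B im inj by (auto simp: BSWEDF_def order_def card_image simp flip: im)
  then show ?thesis
    using B H disj hBs unfolding BSWEDF_def bound_iff card_eq by auto
qed

lemma optimal_BSWEDF_le:
  fixes G :: "('a, 'x) monoid_scheme" and H :: "('b, 'y) monoid_scheme"
  assumes G: "optimal_BSWEDF G n m K a l Bs" and H: "BSWEDF H n m K a' l' Cs"
  shows "l \<le> l'"
proof -
  have cgH: "comm_group H" and fin: "finite (carrier H)"
    using H by (auto simp: BSWEDF_def)
  obtain f :: "'b \<Rightarrow> nat" where inj: "inj_on f (carrier H)"
    using finite_imp_inj_to_nat_seg[OF fin] by blast
  let ?g = "inv_into (carrier H) f"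
  define N :: "nat monoid" where
    "N = \<lparr>carrier = f ` carrier H, mult = (\<lambda>x y. f (?g x \<otimes>\<^bsub>H\<^esub> ?g y)), one = f \<one>\<^bsub>H\<^esub>\<rparr>"
  interpret H: comm_group H by (rule cgH)
  have "comm_group N"
  proof (rule comm_groupI)
    fix x assume "x \<in> carrier N"
    then obtain z where z: "z \<in> carrier H" "x = f z" by (auto simp: N_def)
    then have "f (inv\<^bsub>H\<^esub> z) \<otimes>\<^bsub>N\<^esub> x = \<one>\<^bsub>N\<^esub>" "f (inv\<^bsub>H\<^esub> z) \<in> carrier N"
      using inj by (auto simp: N_def)
    then show "\<exists>y \<in> carrier N. y \<otimes>\<^bsub>N\<^esub> x = \<one>\<^bsub>N\<^esub>" by blast
  qed (use inj in \<open>auto simp: N_def H.m_ac\<close>)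
  moreover have "f \<in> iso H N"
    using inj by (auto simp: N_def iso_def hom_def bij_betw_def)
  ultimately have "BSWEDF N n m K a' l' (map ((`) f) Cs)"
    using BSWEDF_iso H by blast
  then show ?thesis
    using G by (auto simp: optimal_BSWEDF_def)
qed

end

theory Submission
  imports Defs "HOL-Number_Theory.Cong"
begin

text \<open>
  The external differences of a family number \<open>(m - 1) \<sqdot> lcm \<sqdot> a\<close>, here
  \<open>8k(2k + 1)\<close>. As this exceeds \<open>2k(8k + 1) = 2k(n - 1)\<close>, every family with these parameters
  has \<open>\<lambda> \<ge> 2k + 1\<close>. For $\mathcal{S}$ equality holds because an element \<open>(e, z)\<close> with
  \<open>z \<noteq> 0\<close> is a difference exactly \<open>1 + k + k\<close> times, and \<open>(e, 0)\<close> never is: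
  \<open>S2 \<union> S3\<close> meets each pair \<open>{(0, z), (1, z)}\<close> exactly once, so \<open>S1\<close> contributes \<open>1\<close> on the
  left and, with its weight, \<open>k\<close> on the right. Between \<open>S2\<close> and \<open>S3\<close> the differences add up,
  using \<open>-D 0 = D 2\<close> (\<open>k\<close> is odd), to those of a square and a nonsquare, and each
  nonzero \<open>z\<close> is such a difference \<open>k\<close> times.
\<close>

section \<open>The number of external differences\<close>

lemma size_diff_mset: "size (diff_mset G B C) = size B * size C"
  unfolding diff_mset_def by (induction B) auto

text \<open>The division in the weight is exact, since each cardinality divides the lcm. All
  weighted sets therefore have the same size; this makes the total depend only on the sum of the
  cardinalities.\<close>

lemma size_weighted_set:
  assumes "j < length Bs"
  shows "size (weighted_set Bs j) = Lcm (set (map card Bs))"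
proof -
  have "card (Bs ! j) dvd Lcm (set (map card Bs))"
    using assms by (intro dvd_Lcm) simp
  then show ?thesis
    by (simp add: weighted_set_def)
qed

lemma size_sum_multiset: "size (sum f A) = (\<Sum>x\<in>A. size (f x))" for f :: "'a \<Rightarrow> 'b multiset"
  by (induction A rule: infinite_finite_induct) auto

lemma off_diagonal_Sigma:
  "{(i, j). i < m \<and> j < m \<and> i \<noteq> j} = (SIGMA i:{..<m}. {..<m} - {i})" for m :: nat
  by auto

text \<open>Every ordered pair \<open>(i, j)\<close> contributes \<open>card (Bs ! i)\<close> times
  the lcm, whatever \<open>j\<close> is, and each \<open>i\<close> has \<open>length Bs - 1\<close>
  partners.\<close>

lemma size_external_diffs:
  "size (external_diffs G Bs) =
     (length Bs - 1) * Lcm (set (map card Bs)) * sum_list (map card Bs)"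
proof -
  let ?L = "Lcm (set (map card Bs))"
  have "size (external_diffs G Bs) =
      (\<Sum>(i, j)\<in>{(i, j). i < length Bs \<and> j < length Bs \<and> i \<noteq> j}. card (Bs ! i) * ?L)"
    unfolding external_diffs_def size_sum_multiset
    by (intro sum.cong) (auto simp: size_diff_mset size_weighted_set)
  also have "\<dots> = (\<Sum>i<length Bs. \<Sum>j\<in>{..<length Bs} - {i}. card (Bs ! i) * ?L)"
    unfolding off_diagonal_Sigma by (subst sum.Sigma) auto
  also have "\<dots> = (\<Sum>i<length Bs. (length Bs - 1) * ?L * card (Bs ! i))"
    by (intro sum.cong) auto
  also have "\<dots> = (length Bs - 1) * ?L * sum_list (map card Bs)"
    by (simp add: sum_list_sum_nth atLeast0LessThan sum_distrib_left)
  finally show ?thesis .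
qed

text \<open>Multiset inclusion implies an inequality of sizes.\<close>

lemma diffs_bounded_by_imp_le:
  assumes "finite (carrier G)" "\<one>\<^bsub>G\<^esub> \<in> carrier G" "diffs_bounded_by G Bs l"
  shows "(length Bs - 1) * Lcm (set (map card Bs)) * sum_list (map card Bs) \<le> l * (order G - 1)"
proof -
  have "size (external_diffs G Bs) \<le> size (repeat_mset l (mset_set (carrier G - {\<one>\<^bsub>G\<^esub>})))"
    using assms(3) unfolding diffs_bounded_by_def by (rule size_mset_mono)
  then show ?thesis
    using assms(1,2) by (simp add: size_external_diffs order_def)
qed

section \<open>Representations as a difference\<close>

text \<open>The multiplicity is taken as the cardinality of a set of pairs, so that bijections and
  disjoint unions can be applied to it.\<close>

definition diff_count :: "('a, 'x) monoid_scheme \<Rightarrow> 'a set \<Rightarrow> 'a set \<Rightarrow> 'a \<Rightarrow> nat" where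
  "diff_count G A B g = card {(x, y). x \<in> A \<and> y \<in> B \<and> x \<otimes>\<^bsub>G\<^esub> inv\<^bsub>G\<^esub> y = g}"

lemma count_sum_mset_image: "count (\<Sum>x\<in>#M. f x) g = (\<Sum>x\<in>#M. count (f x) g)"
  by (induction M) auto

lemma count_diff_mset:
  assumes "finite A" "finite B"
  shows "count (diff_mset G (mset_set A) (mset_set B)) g = diff_count G A B g"
proof -
  have "count {# x \<otimes>\<^bsub>G\<^esub> inv\<^bsub>G\<^esub> y. y \<in># mset_set B #} g = card {y \<in> B. x \<otimes>\<^bsub>G\<^esub> inv\<^bsub>G\<^esub> y = g}" for x
    using assms(2) by (simp add: count_image_mset' Int_def vimage_def eq_commute conj_commute)
  then have "count (diff_mset G (mset_set A) (mset_set B)) g =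
      (\<Sum>x\<in>A. card {y \<in> B. x \<otimes>\<^bsub>G\<^esub> inv\<^bsub>G\<^esub> y = g})"
    by (simp add: diff_mset_def count_sum_mset_image sum_unfold_sum_mset)
  also have "\<dots> = card (SIGMA x:A. {y \<in> B. x \<otimes>\<^bsub>G\<^esub> inv\<^bsub>G\<^esub> y = g})"
    using assms by simp
  also have "(SIGMA x:A. {y \<in> B. x \<otimes>\<^bsub>G\<^esub> inv\<^bsub>G\<^esub> y = g}) =
      {(x, y). x \<in> A \<and> y \<in> B \<and> x \<otimes>\<^bsub>G\<^esub> inv\<^bsub>G\<^esub> y = g}"
    by auto
  finally show ?thesis
    by (simp add: diff_count_def)
qed

lemma diff_mset_repeat_mset: "diff_mset G B (repeat_mset n C) = repeat_mset n (diff_mset G B C)"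
  unfolding diff_mset_def by (induction B) (auto simp: image_mset_repeat_mset)

lemma finite_diff_count: "finite A \<Longrightarrow> finite B \<Longrightarrow>
    finite {(x, y). x \<in> A \<and> y \<in> B \<and> x \<otimes>\<^bsub>G\<^esub> inv\<^bsub>G\<^esub> y = g}"
  by (rule finite_subset[of _ "A \<times> B"]) auto

lemma diff_count_empty [simp]: "diff_count G {} B g = 0" "diff_count G A {} g = 0"
  by (auto simp: diff_count_def)

lemma diff_count_Un_left:
  assumes "finite A" "finite A'" "finite B" "A \<inter> A' = {}"
  shows "diff_count G (A \<union> A') B g = diff_count G A B g + diff_count G A' B g"
proof -
  have "{(x, y). x \<in> A \<union> A' \<and> y \<in> B \<and> x \<otimes>\<^bsub>G\<^esub> inv\<^bsub>G\<^esub> y = g} =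
      {(x, y). x \<in> A \<and> y \<in> B \<and> x \<otimes>\<^bsub>G\<^esub> inv\<^bsub>G\<^esub> y = g} \<union>
      {(x, y). x \<in> A' \<and> y \<in> B \<and> x \<otimes>\<^bsub>G\<^esub> inv\<^bsub>G\<^esub> y = g}"
    by auto
  then show ?thesis
    unfolding diff_count_def using assms by (auto intro!: card_Un_disjoint finite_diff_count)
qed

lemma (in group) diff_count_singleton_left:
  assumes "x \<in> carrier G" "g \<in> carrier G" "B \<subseteq> carrier G"
  shows "diff_count G {x} B g = (if inv g \<otimes> x \<in> B then 1 else 0)"
proof -
  have "x \<otimes> inv y = g \<longleftrightarrow> y = inv g \<otimes> x" if "y \<in> carrier G" for y
    using assms that inv_solve_left inv_solve_right by metis
  then have "x \<otimes> inv y = g \<longleftrightarrow> y = inv g \<otimes> x" if "y \<in> B" for y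
    using assms that by blast
  then have "{(x', y). x' \<in> {x} \<and> y \<in> B \<and> x' \<otimes> inv y = g} =
      (if inv g \<otimes> x \<in> B then {(x, inv g \<otimes> x)} else {})"
    by (simp add: set_eq_iff) blast
  then show ?thesis
    by (simp add: diff_count_def)
qed

lemma (in group) diff_count_singleton_right:
  assumes "y \<in> carrier G" "g \<in> carrier G" "A \<subseteq> carrier G"
  shows "diff_count G A {y} g = (if g \<otimes> y \<in> A then 1 else 0)"
proof -
  have "x \<otimes> inv y = g \<longleftrightarrow> x = g \<otimes> y" if "x \<in> carrier G" for x
    using assms that inv_solve_right' by metis
  then have "x \<otimes> inv y = g \<longleftrightarrow> x = g \<otimes> y" if "x \<in> A" for x
    using assms that by blast
  then have "{(x, y'). x \<in> A \<and> y' \<in> {y} \<and> x \<otimes> inv y' = g} =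
      (if g \<otimes> y \<in> A then {(g \<otimes> y, y)} else {})"
    by (simp add: set_eq_iff) blast
  then show ?thesis
    by (simp add: diff_count_def)
qed

lemma (in group) diff_count_not_in_carrier:
  assumes "A \<subseteq> carrier G" "B \<subseteq> carrier G" "g \<notin> carrier G"
  shows "diff_count G A B g = 0"
proof -
  have "{(x, y). x \<in> A \<and> y \<in> B \<and> x \<otimes> inv y = g} = {}"
    using assms by (auto simp: subset_iff)
  then show ?thesis
    unfolding diff_count_def by (metis card.empty)
qed

lemma (in group) diff_count_one_disjoint:
  assumes "A \<subseteq> carrier G" "B \<subseteq> carrier G" "A \<inter> B = {}"
  shows "diff_count G A B \<one> = 0"
proof -
  have "x = y" if "x \<in> carrier G" "y \<in> carrier G" "x \<otimes> inv y = \<one>" for x y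
    using that inv_equality inv_inv by fastforce
  then have "{(x, y). x \<in> A \<and> y \<in> B \<and> x \<otimes> inv y = \<one>} = {}"
    using assms by blast
  then show ?thesis
    unfolding diff_count_def by (metis card.empty)
qed

text \<open>Double counting: each pair in \<open>A \<times> B\<close> has exactly one
  difference.\<close>

lemma (in group) sum_diff_count:
  assumes "finite A" "finite B" "A \<subseteq> carrier G" "B \<subseteq> carrier G" "finite (carrier G)"
  shows "(\<Sum>g\<in>carrier G. diff_count G A B g) = card A * card B"
proof -
  have "(\<Sum>g\<in>carrier G. diff_count G A B g) =
      (\<Sum>g\<in>carrier G. \<Sum>p | p \<in> A \<times> B \<and> fst p \<otimes> inv snd p = g. 1)"
    by (auto simp: diff_count_def intro!: sum.cong arg_cong[where f = card])
  also have "\<dots> = (\<Sum>p\<in>A \<times> B. 1)"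
    using assms by (intro sum.group) (auto simp: subset_iff)
  finally show ?thesis
    by (simp add: card_cartesian_product)
qed

text \<open>In additive terms, x - y = (-y) - (-x), so sending (x, y) to (-y, -x) is a bijection
  between the pairs counted.\<close>

lemma (in comm_group) diff_count_inv_swap:
  assumes "A \<subseteq> carrier G" "B \<subseteq> carrier G"
  shows "diff_count G (m_inv G ` B) (m_inv G ` A) g = diff_count G A B g"
proof -
  have inj: "inj_on (\<lambda>(x, y). (inv y, inv x)) {(x, y). x \<in> A \<and> y \<in> B \<and> x \<otimes> inv y = g}"
    using assms by (auto intro!: inj_onI simp: subset_iff)
  have "{(x, y). x \<in> m_inv G ` B \<and> y \<in> m_inv G ` A \<and> x \<otimes> inv y = g} =
      (\<lambda>(x, y). (inv y, inv x)) ` {(x, y). x \<in> A \<and> y \<in> B \<and> x \<otimes> inv y = g}"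
    using assms by (force simp: subset_iff m_comm)
  then show ?thesis
    unfolding diff_count_def using card_image[OF inj] by simp
qed

section \<open>Differences in a product with the group of order two\<close>

lemma comm_group_DirProd:
  assumes "comm_group G" "comm_group H"
  shows "comm_group (G \<times>\<times> H)"
proof -
  interpret G: comm_group G by fact
  interpret H: comm_group H by fact
  interpret GH: group "G \<times>\<times> H"
    by (rule DirProd_group) unfold_locales
  show ?thesis
    by (rule GH.group_comm_groupI) (auto simp: G.m_comm H.m_comm)
qed

text \<open>The first coordinates (a, b) with a - b = e modulo 2 are (e, 0) and (1 - e, 1). Only the
  fibres over these coordinates have to be compared.\<close>

lemma diff_count_Z2_DirProd:
  fixes H :: "('b, 'x) monoid_scheme"
  assumes H: "group H" and e: "e = 0 \<or> e = 1"
    and X: "finite (X 0)" "finite (X 1)"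
    and Y: "Y 0 \<subseteq> carrier H" "Y 1 \<subseteq> carrier H" "finite (Y 0)" "finite (Y 1)"
  shows "diff_count (integer_mod_group 2 \<times>\<times> H) (Sigma {0, 1} X) (Sigma {0, 1} Y) (e, z) =
    diff_count H (X e) (Y 0) z + diff_count H (X (1 - e)) (Y 1) z"
proof -
  let ?D = "\<lambda>A B. {(x, y). x \<in> A \<and> y \<in> B \<and> x \<otimes>\<^bsub>H\<^esub> inv\<^bsub>H\<^esub> y = z}"
  let ?f = "\<lambda>a b (x, y). ((a :: int, x), (b :: int, y))"
  \<comment> \<open>Both elements of the group of order two are their own inverses.\<close>
  have inv: "inv\<^bsub>integer_mod_group 2 \<times>\<times> H\<^esub> (b, y) = (b, inv\<^bsub>H\<^esub> y)"
    if "b = 0 \<or> b = 1" "y \<in> carrier H" for b y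
    using that H by (subst inv_DirProd) (auto simp: carrier_integer_mod_group)
  have "{(p, p'). p \<in> Sigma {0, 1} X \<and> p' \<in> Sigma {0, 1} Y \<and>
         p \<otimes>\<^bsub>integer_mod_group 2 \<times>\<times> H\<^esub> inv\<^bsub>integer_mod_group 2 \<times>\<times> H\<^esub> p' = (e, z)} =
      ?f e 0 ` ?D (X e) (Y 0) \<union> ?f (1 - e) 1 ` ?D (X (1 - e)) (Y 1)"
    (is "?L = ?R")
  proof
    show "?L \<subseteq> ?R"
      using e Y by (auto simp: inv subset_iff image_iff)
    show "?R \<subseteq> ?L"
      using e Y by (auto simp: inv subset_iff image_iff)
  qed
  moreover have "finite (?D (X e) (Y 0))" "finite (?D (X (1 - e)) (Y 1))"
    using e X Y by (auto intro: finite_diff_count)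
  moreover have "card (?f a b ` M) = card M" for a b and M :: "('b \<times> 'b) set"
    by (intro card_image inj_onI) auto
  ultimately show ?thesis
    by (subst diff_count_def, simp, subst card_Un_disjoint) (auto simp: diff_count_def)
qed

text \<open>Multiplication by a nonzero \<open>c\<close> is an automorphism of the additive
  group.\<close>

lemma (in field) diff_count_scale:
  assumes "A \<subseteq> carrier R" "B \<subseteq> carrier R" "c \<in> carrier R" "c \<noteq> \<zero>" "z \<in> carrier R"
  shows "diff_count (add_monoid R) ((\<otimes>) c ` A) ((\<otimes>) c ` B) (c \<otimes> z) =
    diff_count (add_monoid R) A B z"
proof -
  have inj: "inj_on ((\<otimes>) c) (carrier R)"
    using assms m_lcancel by (auto intro!: inj_onI)
  have minus: "c \<otimes> x \<oplus> \<ominus> (c \<otimes> y) = c \<otimes> (x \<oplus> \<ominus> y)" if "x \<in> carrier R" "y \<in> carrier R" for x y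
    using that assms by (simp add: r_distr r_minus)
  have "{(x, y). x \<in> (\<otimes>) c ` A \<and> y \<in> (\<otimes>) c ` B \<and> x \<oplus> \<ominus> y = c \<otimes> z} =
      map_prod ((\<otimes>) c) ((\<otimes>) c) ` {(x, y). x \<in> A \<and> y \<in> B \<and> x \<oplus> \<ominus> y = z}"
    (is "?L = ?R")
  proof
    show "?L \<subseteq> ?R"
    proof clarify
      fix x y assume xy: "x \<in> A" "y \<in> B" "c \<otimes> x \<oplus> \<ominus> (c \<otimes> y) = c \<otimes> z"
      then have car: "x \<in> carrier R" "y \<in> carrier R" using assms by auto
      then have "x \<oplus> \<ominus> y = z"
        using minus[OF car] xy(3) assms inj_onD[OF inj, of "x \<oplus> \<ominus> y" z] by simp
      then show "(c \<otimes> x, c \<otimes> y) \<in> ?R"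
        using xy by (auto intro!: image_eqI[of _ _ "(x, y)"])
    qed
    show "?R \<subseteq> ?L"
      using assms by (auto simp: minus subset_iff)
  qed
  moreover have "inj_on (map_prod ((\<otimes>) c) ((\<otimes>) c)) {(x, y). x \<in> A \<and> y \<in> B \<and> x \<oplus> \<ominus> y = z}"
    using assms inj by (intro inj_on_subset[OF map_prod_inj_on[OF inj inj]]) auto
  ultimately show ?thesis
    by (simp add: diff_count_def card_image flip: a_inv_def)
qed

section \<open>Cyclotomic classes of order four\<close>

locale quartic_field = field R for R (structure) and \<alpha> and k :: nat +
  assumes finite_carrier: "finite (carrier R)"
    and order_carrier: "order R = 4 * k + 1"
    and odd_k: "odd k"
    and primitive: "primitive_element R \<alpha>"
begin

abbreviation "D i \<equiv> quartic_class R \<alpha> k i"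

lemma k_pos: "0 < k"
  using odd_k by (rule odd_pos)

section \<open>Powers of the primitive element\<close>

lemma alpha_closed [simp]: "\<alpha> \<in> carrier R" and alpha_nonzero: "\<alpha> \<noteq> \<zero>"
  using primitive by (auto simp: primitive_element_def)

lemma pow_nonzero: "\<alpha> [^] (n :: nat) \<noteq> \<zero>"
  using alpha_nonzero by (induction n) (auto simp: integral_iff)

text \<open>The order of \<open>\<alpha>\<close> is that of the multiplicative group,
  \<open>4 * k\<close>. These three facts turn statements about nonzero elements into statements
  about exponents modulo \<open>4 * k\<close>.\<close>

lemma pow_order_eq_one: "\<alpha> [^] (4 * k) = \<one>"
  and pow_eq_imp_cong: "\<alpha> [^] m = \<alpha> [^] n \<Longrightarrow> [m = n] (mod (4 * k))"
  and ex_pow: "x \<in> carrier R \<Longrightarrow> x \<noteq> \<zero> \<Longrightarrow> \<exists>n::nat. x = \<alpha> [^] n"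
proof -
  interpret M: group "mult_of R"
    by (rule field_mult_group)
  have a: "\<alpha> \<in> carrier (mult_of R)" and gen: "generate (mult_of R) {\<alpha>} = carrier (mult_of R)"
    using primitive by (simp_all add: primitive_element_def)
  have "M.ord \<alpha> = order (mult_of R)"
    using M.generate_pow_card[OF a] gen by (simp add: order_def)
  then have ord: "M.ord \<alpha> = 4 * k"
    using order_mult_of finite_carrier order_carrier by simp
  then show "\<alpha> [^] (4 * k) = \<one>"
    using M.pow_ord_eq_1[OF a] by (simp add: nat_pow_mult_of)
  \<comment> \<open>Exponents are natural numbers, so their difference is formed with the larger one
    first; the other case follows by symmetry.\<close>
  have le: "[m = n] (mod (4 * k))" if "n \<le> m" "\<alpha> [^] m = \<alpha> [^] n" for m n :: nat
  proof -
    have "4 * k dvd m - n"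
      using M.pow_eq_div2[OF a] M.pow_eq_id[OF a] that ord by (simp add: nat_pow_mult_of)
    then show ?thesis
      using that(1) by (simp add: cong_altdef_nat)
  qed
  show "[m = n] (mod (4 * k))" if "\<alpha> [^] m = \<alpha> [^] n"
    using le[of n m] le[of m n] that cong_sym by (cases "n \<le> m") auto
  show "\<exists>n::nat. x = \<alpha> [^] n" if "x \<in> carrier R" "x \<noteq> \<zero>"
    using that gen M.generate_pow_on_finite_carrier[OF finite_mult_of[OF finite_carrier] a]
    by (auto simp: nat_pow_mult_of)
qed

text \<open>This power squares to 1 but is not 1, as \<open>2 * k\<close> lies strictly between 0
  and the order \<open>4 * k\<close>.\<close>

lemma pow_half_order: "\<alpha> [^] (2 * k) = \<ominus> \<one>"
proof -
  have "\<alpha> [^] (2 * k) \<otimes> \<alpha> [^] (2 * k) = \<one>"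
    using pow_order_eq_one by (simp add: nat_pow_mult)
  moreover have "\<alpha> [^] (2 * k) \<noteq> \<one>"
    using pow_eq_imp_cong[of "2 * k" 0] k_pos by (auto simp: cong_0_iff dest: dvd_imp_le)
  ultimately show ?thesis
    using square_eq_one[of "\<alpha> [^] (2 * k)"] by auto
qed

lemma minus_pow: "\<ominus> (\<alpha> [^] n) = \<alpha> [^] (n + 2 * k)"
  by (simp add: pow_half_order r_minus flip: nat_pow_mult)

text \<open>Exponents matter only modulo \<open>4 * k\<close>, a multiple of 4, so their residue
  modulo 4 is well defined and determines the class.\<close>

lemma pow_in_class_iff:
  assumes "i < 4"
  shows "\<alpha> [^] n \<in> D i \<longleftrightarrow> n mod 4 = i"
proof
  assume "\<alpha> [^] n \<in> D i"
  then obtain j where "[n = i + 4 * j] (mod (4 * k))"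
    using pow_eq_imp_cong by (auto simp: quartic_class_def)
  then have "[n = i + 4 * j] (mod 4)"
    by (rule cong_dvd_modulus_nat) simp
  then show "n mod 4 = i"
    using assms by (simp add: cong_def)
next
  assume n: "n mod 4 = i"
  \<comment> \<open>Reducing the quotient modulo \<open>k\<close> brings it into the range used by
    \<open>quartic_class\<close>; the exponent changes by a multiple of
    \<open>4 * k\<close>.\<close>
  define j where "j = n div 4 mod k"
  have "n = i + 4 * (n div 4)"
    using n by (metis mod_mult_div_eq)
  also have "n div 4 = j + k * (n div 4 div k)"
    by (simp add: j_def)
  finally have eq: "n = (i + 4 * j) + (4 * k) * (n div 4 div k)"
    by (simp add: algebra_simps)
  have "\<alpha> [^] n = \<alpha> [^] (i + 4 * j) \<otimes> (\<alpha> [^] (4 * k)) [^] (n div 4 div k)"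
    by (subst eq) (simp only: nat_pow_mult nat_pow_pow alpha_closed)
  then have "\<alpha> [^] n = \<alpha> [^] (i + 4 * j)"
    by (simp add: pow_order_eq_one)
  moreover have "j < k"
    using k_pos by (simp add: j_def)
  ultimately show "\<alpha> [^] n \<in> D i"
    by (auto simp: quartic_class_def)
qed

section \<open>The four classes under negation and multiplication\<close>

lemma class_elem_pow: "x \<in> D i \<Longrightarrow> \<exists>n::nat. x = \<alpha> [^] n"
  by (auto simp: quartic_class_def)

lemma class_closed: "D i \<subseteq> carrier R"
  by (auto simp: quartic_class_def)

lemma finite_class [simp]: "finite (D i)"
  using class_closed finite_carrier by (rule finite_subset)

lemma zero_notin_class [simp]: "\<zero> \<notin> D i"
  using pow_nonzero by (fastforce simp: quartic_class_def)

lemma class_disjoint: "i < 4 \<Longrightarrow> j < 4 \<Longrightarrow> i \<noteq> j \<Longrightarrow> D i \<inter> D j = {}"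
  using class_elem_pow pow_in_class_iff by (fastforce simp: disjoint_iff)

lemma class_cover:
  assumes "x \<in> carrier R" "x \<noteq> \<zero>"
  shows "x \<in> D 0 \<or> x \<in> D 1 \<or> x \<in> D 2 \<or> x \<in> D 3"
proof -
  obtain n where n: "x = \<alpha> [^] (n :: nat)"
    using ex_pow assms by blast
  have "n mod 4 = 0 \<or> n mod 4 = 1 \<or> n mod 4 = 2 \<or> n mod 4 = 3"
    by presburger
  then show ?thesis
    unfolding n by (simp add: pow_in_class_iff)
qed

lemma card_class:
  assumes "i < 4"
  shows "card (D i) = k"
proof -
  have "inj_on (\<lambda>j. \<alpha> [^] (i + 4 * j)) {..<k}"
  proof (rule inj_onI)
    fix j j' assume jj: "j \<in> {..<k}" "j' \<in> {..<k}" "\<alpha> [^] (i + 4 * j) = \<alpha> [^] (i + 4 * j')"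
    have "i + 4 * j < 4 * k" "i + 4 * j' < 4 * k"
      using assms jj by auto
    then have "i + 4 * j = i + 4 * j'"
      using pow_eq_imp_cong[OF jj(3)] cong_less_modulus_unique_nat by blast
    then show "j = j'" by simp
  qed
  moreover have "D i = (\<lambda>j. \<alpha> [^] (i + 4 * j)) ` {..<k}"
    by (auto simp: quartic_class_def)
  ultimately show ?thesis
    by (simp add: card_image)
qed

text \<open>Negation adds \<open>2 * k\<close> to the exponent, and \<open>2 * k\<close> is 2 modulo
  4 because \<open>k\<close> is odd.\<close>

lemma minus_class:
  assumes "i < 4" "(i + 2) mod 4 = j"
  shows "a_inv R ` D i = D j"
proof -
  have *: "\<ominus> x \<in> D ((i + 2) mod 4)" if i: "x \<in> D i" "i < 4" for x i
  proof -
    obtain n where n: "x = \<alpha> [^] (n :: nat)" "n mod 4 = i"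
      using i class_elem_pow pow_in_class_iff by blast
    obtain l where "k = 2 * l + 1"
      using odd_k by (rule oddE)
    then have "n + 2 * k = (n + 2) + 4 * l"
      by simp
    then have "(n + 2 * k) mod 4 = (i + 2) mod 4"
      using n(2) by (metis mod_add_left_eq mod_mult_self2)
    then show ?thesis
      using n(1) by (simp add: minus_pow pow_in_class_iff)
  qed
  show ?thesis
  proof
    show "a_inv R ` D i \<subseteq> D j"
      using *[of _ i] assms by auto
    show "D j \<subseteq> a_inv R ` D i"
    proof
      fix x assume x: "x \<in> D j"
      \<comment> \<open>Two shifts by 2 cancel modulo 4, so \<open>*\<close> applied to class
        \<open>j\<close> yields the reverse inclusion.\<close>
      have "(j + 2) mod 4 = i"
        using assms by (auto simp: mod_simps)
      moreover have "j < 4"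
        using assms by auto
      ultimately have "\<ominus> x \<in> D i"
        using *[OF x] by simp
      moreover have "x = \<ominus> (\<ominus> x)"
        using x class_closed by (metis minus_minus subsetD)
      ultimately show "x \<in> a_inv R ` D i"
        by blast
    qed
  qed
qed

text \<open>Multiplication by \<open>\<alpha>\<close> adds 1 to the exponent.\<close>

lemma alpha_mult_class:
  assumes "i < 4" "Suc i mod 4 = j"
  shows "(\<otimes>) \<alpha> ` D i = D j"
proof
  have *: "\<alpha> \<otimes> \<alpha> [^] n \<in> D j \<longleftrightarrow> \<alpha> [^] n \<in> D i" for n :: nat
  proof -
    have "\<alpha> \<otimes> \<alpha> [^] n = \<alpha> [^] Suc n"
      by (simp add: m_comm)
    moreover have "Suc n mod 4 = j \<longleftrightarrow> n mod 4 = i"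
      using assms by (auto simp: mod_Suc split: if_splits)
    moreover have "j < 4"
      using assms(2) by auto
    ultimately show ?thesis
      using assms(1) by (simp only: pow_in_class_iff)
  qed
  show "(\<otimes>) \<alpha> ` D i \<subseteq> D j"
    using class_elem_pow * by fastforce
  show "D j \<subseteq> (\<otimes>) \<alpha> ` D i"
  proof
    fix x assume x: "x \<in> D j"
    then have x': "x \<in> carrier R" "x \<noteq> \<zero>"
      using class_closed by auto
    have "\<alpha> \<in> Units R"
      using alpha_nonzero by (simp add: field_Units)
    then have inv: "\<alpha> \<otimes> (inv \<alpha> \<otimes> x) = x" "inv \<alpha> \<otimes> x \<in> carrier R"
      using x' by (simp_all flip: m_assoc)
    moreover have "inv \<alpha> \<otimes> x \<noteq> \<zero>"
      using inv x' by auto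
    ultimately obtain n where "\<alpha> \<otimes> \<alpha> [^] (n :: nat) = x"
      using ex_pow by metis
    then show "x \<in> (\<otimes>) \<alpha> ` D i"
      using * x by blast
  qed
qed

section \<open>Squares and nonsquares\<close>

abbreviation "count_add \<equiv> diff_count (add_monoid R)"

text \<open>These are the even and the odd powers of \<open>\<alpha>\<close>. Zero is left out of
  both.\<close>

definition "squares = D 0 \<union> D 2"
definition "nonsquares = D 1 \<union> D 3"

lemma squares_closed: "squares \<subseteq> carrier R" and nonsquares_closed: "nonsquares \<subseteq> carrier R"
  using class_closed by (auto simp: squares_def nonsquares_def)

lemma finite_squares [simp]: "finite squares" and finite_nonsquares [simp]: "finite nonsquares"
  by (simp_all add: squares_def nonsquares_def)

lemma card_squares: "card squares = 2 * k" and card_nonsquares: "card nonsquares = 2 * k"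
  by (simp_all add: squares_def nonsquares_def card_Un_disjoint class_disjoint card_class)

lemma squares_nonsquares_disjoint: "squares \<inter> nonsquares = {}"
  by (simp add: squares_def nonsquares_def Int_Un_distrib Int_Un_distrib2 class_disjoint)

lemma minus_squares: "a_inv R ` squares = squares"
  and minus_nonsquares: "a_inv R ` nonsquares = nonsquares"
proof -
  have "a_inv R ` D 0 = D 2" "a_inv R ` D 2 = D 0" "a_inv R ` D 1 = D 3" "a_inv R ` D 3 = D 1"
    by (rule minus_class; simp)+
  then show "a_inv R ` squares = squares" "a_inv R ` nonsquares = nonsquares"
    unfolding squares_def nonsquares_def image_Un by blast+
qed

lemma alpha_mult_squares: "(\<otimes>) \<alpha> ` squares = nonsquares"
  and alpha_mult_nonsquares: "(\<otimes>) \<alpha> ` nonsquares = squares"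
proof -
  have "(\<otimes>) \<alpha> ` D 0 = D 1" "(\<otimes>) \<alpha> ` D 1 = D 2" "(\<otimes>) \<alpha> ` D 2 = D 3" "(\<otimes>) \<alpha> ` D 3 = D 0"
    by (rule alpha_mult_class; simp)+
  then show "(\<otimes>) \<alpha> ` squares = nonsquares" "(\<otimes>) \<alpha> ` nonsquares = squares"
    unfolding squares_def nonsquares_def image_Un by blast+
qed

lemma count_add_minus_swap:
  assumes "A \<subseteq> carrier R" "B \<subseteq> carrier R"
  shows "count_add (a_inv R ` B) (a_inv R ` A) z = count_add A B z"
  using comm_group.diff_count_inv_swap[OF a_comm_group] assms by (simp flip: a_inv_def)

text \<open>
  Multiplication by \<open>\<alpha>\<close> swaps squares and nonsquares, and \<open>x - y = (-y) - (-x)\<close> swaps them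
  back because \<open>-1\<close> is a square. Hence the count is constant on the nonzero elements.
\<close>

lemma count_squares_nonsquares_alpha_mult:
  assumes "z \<in> carrier R"
  shows "count_add squares nonsquares (\<alpha> \<otimes> z) = count_add squares nonsquares z"
proof -
  have "count_add squares nonsquares (\<alpha> \<otimes> z) = count_add nonsquares squares (\<alpha> \<otimes> z)"
    using count_add_minus_swap[OF nonsquares_closed squares_closed]
    by (simp add: minus_squares minus_nonsquares)
  also have "\<dots> = count_add squares nonsquares z"
    using diff_count_scale[OF squares_closed nonsquares_closed alpha_closed alpha_nonzero assms]
    by (simp add: alpha_mult_squares alpha_mult_nonsquares)
  finally show ?thesis .
qed

lemma add_group: "group (add_monoid R)"
  by (rule a_group)

lemma count_squares_nonsquares_zero: "count_add squares nonsquares \<zero> = 0"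
  using group.diff_count_one_disjoint[OF add_group] squares_closed nonsquares_closed
    squares_nonsquares_disjoint by simp

text \<open>The count takes one value c on the \<open>4 * k\<close> nonzero elements and vanishes at
  zero. Summing over the field gives 4kc = (2k)(2k), hence c = k.\<close>

lemma count_squares_nonsquares:
  assumes "z \<in> carrier R" "z \<noteq> \<zero>"
  shows "count_add squares nonsquares z = k"
proof -
  \<comment> \<open>Invariance under multiplication by \<open>\<alpha>\<close> carries the value at
    1 to every power, hence to every nonzero element.\<close>
  have pow: "count_add squares nonsquares (\<alpha> [^] n) = count_add squares nonsquares \<one>" for n :: nat
    by (induction n) (simp_all add: count_squares_nonsquares_alpha_mult m_comm)
  have const: "count_add squares nonsquares x = count_add squares nonsquares \<one>"
    if "x \<in> carrier R - {\<zero>}" for x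
    using ex_pow[of x] pow that by auto
  have "2 * k * (2 * k) = (\<Sum>x\<in>carrier R. count_add squares nonsquares x)"
    using group.sum_diff_count[OF add_group, of squares nonsquares] finite_carrier
      squares_closed nonsquares_closed by (simp add: card_squares card_nonsquares)
  also have "\<dots> = (\<Sum>x\<in>carrier R - {\<zero>}. count_add squares nonsquares x)"
    using finite_carrier by (simp add: sum.remove[of _ \<zero>] count_squares_nonsquares_zero)
  also have "\<dots> = (\<Sum>x\<in>carrier R - {\<zero>}. count_add squares nonsquares \<one>)"
    using const by (rule sum.cong[OF refl])
  also have "\<dots> = 4 * k * count_add squares nonsquares \<one>"
    using finite_carrier order_carrier by (simp add: order_def)
  finally have "count_add squares nonsquares \<one> = k"
    using k_pos by simp
  then show ?thesis
    using const[of z] assms by simp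
qed

section \<open>The family in \<open>\<int>\<^sub>2 \<times> F\<close>\<close>

abbreviation "G \<equiv> integer_mod_group 2 \<times>\<times> add_monoid R"

definition "S1 = {(0 :: int, \<zero>), (1, \<zero>)}"
definition "S2 = {0 :: int} \<times> D 0 \<union> {1} \<times> D 2"
definition "S3 = {0 :: int} \<times> D 1 \<union> {0} \<times> D 3"

text \<open>Fibres over the first coordinate, in the form that \<open>diff_count_Z2_DirProd\<close>
  takes. Only 0 and 1 occur as arguments, so the else branch is the fibre over 1.\<close>

abbreviation "slice1 \<equiv> \<lambda>e :: int. {\<zero>}"
abbreviation "slice2 \<equiv> \<lambda>e :: int. if e = 0 then D 0 else D 2"
abbreviation "slice3 \<equiv> \<lambda>e :: int. if e = 0 then nonsquares else {}"

lemma S1_eq: "S1 = Sigma {0, 1} slice1"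
  and S2_eq: "S2 = Sigma {0, 1} slice2"
  and S3_eq: "S3 = Sigma {0, 1} slice3"
  by (auto simp: S1_def S2_def S3_def nonsquares_def split: if_splits)

lemma finite_S [simp]: "finite S1" "finite S2" "finite S3"
  by (simp_all add: S1_def S2_def S3_def)

lemma card_S: "card S1 = 2" "card S2 = 2 * k" "card S3 = 2 * k"
proof -
  show "card S1 = 2"
    by (simp add: S1_def)
  show "card S2 = 2 * k"
    by (simp add: S2_eq card_class)
  show "card S3 = 2 * k"
    by (simp add: S3_eq card_nonsquares)
qed

lemma carrier_G: "carrier G = {0, 1} \<times> carrier R"
  by (auto simp: carrier_integer_mod_group)

lemma comm_group_G: "comm_group G"
  by (rule comm_group_DirProd) (simp_all add: a_comm_group)

lemma S_closed: "S1 \<subseteq> carrier G" "S2 \<subseteq> carrier G" "S3 \<subseteq> carrier G"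
  using class_closed by (auto simp: carrier_G S1_def S2_def S3_def simp del: carrier_DirProd)

lemma S_disjoint: "S1 \<inter> S2 = {}" "S1 \<inter> S3 = {}" "S2 \<inter> S3 = {}"
  using class_disjoint[of 0 1] class_disjoint[of 0 3]
  by (auto simp: S1_def S2_def S3_def)

text \<open>The two fibres of \<open>S2\<close> and the fibre of \<open>S3\<close> over 0 partition
  the nonzero elements. The numerical form lets the counts be added.\<close>

lemma indicator_classes:
  assumes "x \<in> carrier R"
  shows "of_bool (x \<in> D 0) + of_bool (x \<in> D 2) + of_bool (x \<in> nonsquares) = (of_bool (x \<noteq> \<zero>) :: nat)"
  using class_cover[OF assms] class_disjoint[of 0 1] class_disjoint[of 0 2] class_disjoint[of 0 3]
    class_disjoint[of 2 1] class_disjoint[of 2 3]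
  by (auto simp: nonsquares_def)

lemma count_add_zero_left:
  assumes "z \<in> carrier R" "B \<subseteq> carrier R"
  shows "count_add {\<zero>} B z = of_bool (\<ominus> z \<in> B)"
  using group.diff_count_singleton_left[OF add_group, of \<zero> z B] assms
  by (simp flip: a_inv_def)

lemma count_add_zero_right:
  assumes "z \<in> carrier R" "A \<subseteq> carrier R"
  shows "count_add A {\<zero>} z = of_bool (z \<in> A)"
  using group.diff_count_singleton_right[OF add_group, of \<zero> z A] assms by simp

section \<open>Multiplicities between the members of the family\<close>

context
  fixes e :: int and z
  assumes e: "e = 0 \<or> e = 1" and z: "z \<in> carrier R"
begin

text \<open>Both fibres of \<open>S1\<close> are {0}, so both fibres of the other set contribute for
  either \<open>e\<close>. The fibre of \<open>S3\<close> over 1 is empty, so against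
  \<open>S3\<close> only the fibre of \<open>S2\<close> over \<open>e\<close> survives.\<close>

lemma count_slices:
  "diff_count G S1 S2 (e, z) = count_add {\<zero>} (D 0) z + count_add {\<zero>} (D 2) z"
  "diff_count G S1 S3 (e, z) = count_add {\<zero>} nonsquares z"
  "diff_count G S2 S1 (e, z) = count_add (D 0) {\<zero>} z + count_add (D 2) {\<zero>} z"
  "diff_count G S3 S1 (e, z) = count_add nonsquares {\<zero>} z"
  "diff_count G S2 S3 (e, z) = count_add (slice2 e) nonsquares z"
  "diff_count G S3 S2 (e, z) = count_add nonsquares (slice2 e) z"
  unfolding S1_eq S2_eq S3_eq
  by (subst diff_count_Z2_DirProd[OF add_group e]; use e class_closed nonsquares_closed in auto)+

text \<open>A difference 0 - y equals \<open>z\<close> when y is the negative of \<open>z\<close>,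
  and this negative lies in exactly one of the three sets of \<open>indicator_classes\<close> unless
  it is zero.\<close>

lemma count_S1_left:
  "diff_count G S1 S2 (e, z) + diff_count G S1 S3 (e, z) = of_bool (z \<noteq> \<zero>)"
proof -
  have "\<ominus> z \<noteq> \<zero> \<longleftrightarrow> z \<noteq> \<zero>"
    using z minus_minus minus_zero by metis
  then show ?thesis
    using z indicator_classes[of "\<ominus> z"] class_closed nonsquares_closed
    by (simp only: count_slices count_add_zero_left a_inv_closed)
qed

lemma count_S1_right:
  "diff_count G S2 S1 (e, z) + diff_count G S3 S1 (e, z) = of_bool (z \<noteq> \<zero>)"
  using z indicator_classes[of z] class_closed nonsquares_closed
  by (simp only: count_slices count_add_zero_right)

lemma count_S2_S3:
  "diff_count G S2 S3 (e, z) + diff_count G S3 S2 (e, z) = k * of_bool (z \<noteq> \<zero>)"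
proof -
  \<comment> \<open>Exchanging the two sides negates both sets: \<open>nonsquares\<close> is
    preserved and class \<open>i\<close> moves to class \<open>i + 2\<close>. The two directions
    between \<open>S2\<close> and \<open>S3\<close> thus supply \<open>D 0\<close> and
    \<open>D 2\<close> once each, together \<open>squares\<close>.\<close>
  have swap: "count_add nonsquares (D i) z = count_add (D j) nonsquares z"
    if "i < 4" "(i + 2) mod 4 = j" for i j
    using count_add_minus_swap[OF nonsquares_closed class_closed, of i z] minus_class[OF that]
    by (simp add: minus_nonsquares)
  have "diff_count G S2 S3 (e, z) + diff_count G S3 S2 (e, z) =
      count_add (D 0) nonsquares z + count_add (D 2) nonsquares z"
    unfolding count_slices using e swap[of 0 2] swap[of 2 0] by auto
  also have "\<dots> = count_add squares nonsquares z"
    unfolding squares_def by (simp add: diff_count_Un_left class_disjoint)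
  finally show ?thesis
    using z count_squares_nonsquares count_squares_nonsquares_zero by auto
qed

end

section \<open>The multiset of external differences\<close>

lemma Lcm_card_S: "Lcm (set (map card [S1, S2, S3])) = 2 * k"
  by (simp add: card_S)

lemma external_diffs_S:
  "external_diffs G [S1, S2, S3] =
     diff_mset G (mset_set S1) (mset_set S2) + diff_mset G (mset_set S1) (mset_set S3) +
     repeat_mset k (diff_mset G (mset_set S2) (mset_set S1) + diff_mset G (mset_set S3) (mset_set S1)) +
     (diff_mset G (mset_set S2) (mset_set S3) + diff_mset G (mset_set S3) (mset_set S2))"
proof -
  \<comment> \<open>The lcm \<open>2 * k\<close> gives \<open>S1\<close> the weight
    \<open>k\<close>, while \<open>S2\<close> and \<open>S3\<close> keep the weight 1.\<close>
  have w: "weighted_set [S1, S2, S3] 0 = repeat_mset k (mset_set S1)"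
    "weighted_set [S1, S2, S3] 1 = mset_set S2"
    "weighted_set [S1, S2, S3] 2 = mset_set S3"
    using k_pos unfolding weighted_set_def Lcm_card_S by (simp_all add: card_S)
  have idx: "{(i, j). i < length [S1, S2, S3] \<and> j < length [S1, S2, S3] \<and> i \<noteq> j} =
      {(0, 1), (0, 2), (1, 0), (2, 0), (1, 2), (2, 1)}"
    by auto
  show ?thesis
    unfolding external_diffs_def idx
    using w by (simp add: diff_mset_repeat_mset)
qed

text \<open>For a nonzero second coordinate the three groups contribute 1, \<open>k\<close> and
  \<open>k\<close>.\<close>

lemma count_external_diffs_S:
  "count (external_diffs G [S1, S2, S3]) g =
     (2 * k + 1) * of_bool (g \<in> {0, 1} \<times> (carrier R - {\<zero>}))"
proof -
  have eq: "count (external_diffs G [S1, S2, S3]) g =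
      (diff_count G S1 S2 g + diff_count G S1 S3 g) +
      k * (diff_count G S2 S1 g + diff_count G S3 S1 g) +
      (diff_count G S2 S3 g + diff_count G S3 S2 g)"
    by (simp add: external_diffs_S count_diff_mset add_mult_distrib2)
  show ?thesis
  proof (cases "g \<in> carrier G")
    case True
    then obtain e z where g: "g = (e, z)" and e: "e = 0 \<or> e = 1" and z: "z \<in> carrier R"
      unfolding carrier_G by blast
    have "g \<in> {0, 1} \<times> (carrier R - {\<zero>}) \<longleftrightarrow> z \<noteq> \<zero>"
      using g e z by auto
    then show ?thesis
      unfolding eq unfolding g count_S1_left[OF e z] count_S1_right[OF e z] count_S2_S3[OF e z]
      by simp
  next
    case False
    interpret G: comm_group G
      by (rule comm_group_G)
    have zero: "diff_count G A B g = 0" if "A \<subseteq> carrier G" "B \<subseteq> carrier G" for A B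
      using that False by (rule G.diff_count_not_in_carrier)
    have "g \<notin> {0, 1} \<times> (carrier R - {\<zero>})"
      using False unfolding carrier_G by blast
    then show ?thesis
      unfolding eq by (simp only: zero S_closed) simp
  qed
qed

text \<open>The inclusion is strict: (1, 0) is not the neutral element, yet it is never a
  difference.\<close>

lemma diffs_bounded_by_S: "diffs_bounded_by G [S1, S2, S3] (2 * k + 1)"
  unfolding diffs_bounded_by_def
proof (rule mset_subset_eqI)
  fix g
  have "finite (carrier G - {\<one>\<^bsub>G\<^esub>})"
    using finite_carrier unfolding carrier_G by simp
  moreover have "g \<in> carrier G - {\<one>\<^bsub>G\<^esub>}" if "g \<in> {0, 1} \<times> (carrier R - {\<zero>})"
    using that unfolding carrier_G by auto
  ultimately show "count (external_diffs G [S1, S2, S3]) g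
      \<le> count (repeat_mset (2 * k + 1) (mset_set (carrier G - {\<one>\<^bsub>G\<^esub>}))) g"
    unfolding count_external_diffs_S by (cases "g \<in> {0, 1} \<times> (carrier R - {\<zero>})") simp_all
qed

section \<open>Lower bound for \<lambda> and optimality\<close>

lemma order_G: "order G = 2 * (4 * k + 1)"
  using order_carrier unfolding order_def carrier_G by (simp add: card_cartesian_product)

text \<open>Stated for any abelian group of this order, so that it yields both the minimality of
  \<lambda> for the given family and the comparison with all others.\<close>

lemma bound_ge:
  assumes "comm_group H" "finite (carrier H)" "order H = 2 * (4 * k + 1)"
    and "length Bs = 3" "map card Bs = [2, 2 * k, 2 * k]" "diffs_bounded_by H Bs l"
  shows "2 * k + 1 \<le> l"
proof (rule ccontr)
  assume "\<not> 2 * k + 1 \<le> l"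
  then have "l \<le> 2 * k" by simp
  have "set (map card Bs) = {2, 2 * k}"
    using assms(5) by simp
  then have "Lcm (set (map card Bs)) = 2 * k"
    by simp
  moreover have "\<one>\<^bsub>H\<^esub> \<in> carrier H"
    using assms(1) by (simp add: comm_group_def group_def)
  \<comment> \<open>The left factors are m - 1 = 2, the lcm \<open>2 * k\<close> and the sum of the
    cardinalities; on the right, \<open>8 * k + 1\<close> is n - 1.\<close>
  ultimately have "2 * (2 * k) * (4 * k + 2) \<le> l * (8 * k + 1)"
    using diffs_bounded_by_imp_le[of H Bs l] assms by simp
  also have "\<dots> \<le> 2 * k * (8 * k + 1)"
    using \<open>l \<le> 2 * k\<close> by (rule mult_le_mono1)
  \<comment> \<open>Cancelling the positive factor \<open>2 * k\<close> leaves 8k + 4 at most 8k +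
    1.\<close>
  finally have "2 * (4 * k + 2) \<le> 8 * k + 1"
    using k_pos by (simp add: mult.assoc)
  then show False by simp
qed

lemma BSWEDF_S:
  "BSWEDF G (2 * (4 * k + 1)) 3 [2, 2 * k, 2 * k] (4 * k + 2) (2 * k + 1) [S1, S2, S3]"
proof -
  have fin: "finite (carrier G)"
    using finite_carrier unfolding carrier_G by simp
  have card: "map card [S1, S2, S3] = [2, 2 * k, 2 * k]"
    by (simp add: card_S)
  \<comment> \<open>The general lower bound, applied to this very group and family, shows that no
    smaller \<lambda> works.\<close>
  have min: "2 * k + 1 \<le> l" if "diffs_bounded_by G [S1, S2, S3] l" for l
    using bound_ge[OF comm_group_G fin order_G _ card that] by simp
  have "S1 \<noteq> {}" "S2 \<noteq> {}" "S3 \<noteq> {}"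
    using card_S k_pos by auto
  moreover have "[S1, S2, S3] ! i \<inter> [S1, S2, S3] ! j = {}" if "i < 3" "j < 3" "i \<noteq> j" for i j
  proof -
    have "i = 0 \<or> i = 1 \<or> i = 2" "j = 0 \<or> j = 1 \<or> j = 2"
      using that by linarith+
    then show ?thesis
      using that S_disjoint by (auto simp: Int_commute)
  qed
  ultimately show ?thesis
    unfolding BSWEDF_def card
    using comm_group_G fin order_G S_closed diffs_bounded_by_S min by auto
qed

lemma optimal_BSWEDF_S:
  "optimal_BSWEDF G (2 * (4 * k + 1)) 3 [2, 2 * k, 2 * k] (4 * k + 2) (2 * k + 1) [S1, S2, S3]"
  unfolding optimal_BSWEDF_def
proof (intro conjI BSWEDF_S allI impI)
  fix H :: "nat monoid" and a' l' Cs
  assume "BSWEDF H (2 * (4 * k + 1)) 3 [2, 2 * k, 2 * k] a' l' Cs"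
  then have "comm_group H" "finite (carrier H)" "order H = 2 * (4 * k + 1)" "length Cs = 3"
    "map card Cs = [2, 2 * k, 2 * k]" "diffs_bounded_by H Cs l'"
    by (simp_all only: BSWEDF_def)
  then show "2 * k + 1 \<le> l'"
    by (rule bound_ge)
qed

end

theorem theorem3:
  fixes R :: "('a, 'x) ring_scheme" and q k :: nat and \<alpha> :: 'a
  assumes "field R" and "finite (carrier R)" and "order R = q"
    and "primepow q" and "q = 4 * k + 1" and "odd k"
    and "primitive_element R \<alpha>"
  defines "D \<equiv> quartic_class R \<alpha> k"
  shows "optimal_BSWEDF (integer_mod_group 2 \<times>\<times> add_monoid R)
           (2 * q) 3 [2, 2 * k, 2 * k] (4 * k + 2) (2 * k + 1)
           [{(0, \<zero>\<^bsub>R\<^esub>), (1, \<zero>\<^bsub>R\<^esub>)},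
            ({0} \<times> D 0) \<union> ({1} \<times> D 2),
            ({0} \<times> D 1) \<union> ({0} \<times> D 3)]"
proof -
  have "quartic_field R \<alpha> k"
    using assms by (auto simp: quartic_field_def quartic_field_axioms_def)
  then interpret quartic_field R \<alpha> k .
  show ?thesis
    using optimal_BSWEDF_S unfolding S1_def S2_def S3_def D_def \<open>q = 4 * k + 1\<close> .
qed

end
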